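(* Consider the accelerated sticky particle dynamics (see context) with initial mass distribution $P_0$ of total mass $1$, initial velocity function $u_0$ and non-increasing initial acceleration function $\gamma_0$, and let $\phi,u,\gamma$ be the associated flow, Eulerian velocity and Eulerian acceleration (see context). Let $X_0$ be a random variable with distribution $P_0$ and let $X_t=\phi(X_0,t)$ for $t\ge0$. Then the process $t\mapsto X_t$ is absolutely continuous, the processes $t\mapsto u(X_t,t)$ and $t\mapsto\gamma(X_t,t)$ are càdlàg on $(0,\infty)$, and all three processes are right-continuous at $0$. Moreover $t\mapsto X_t$ and $t\mapsto u(X_t,t)$ have right-hand derivatives, given by $$\frac{dX_t}{dt}=\mathbb{E}\left[u_0(X_0)+t\gamma_0(X_0)\,\middle|\,X_t\right],\qquad \frac{d\,u(X_t,t)}{dt}=\mathbb{E}\left[\gamma_0(X_0)\,\middle|\,X_t\right].$$ In addition, for all $t$, $$X_t=\mathbb{E}\left[X_0+tu_0(X_0)+\tfrac{t^2}{2}\gamma_0(X_0)\,\middle|\,X_t\right],$$ $$u(X_t,t)=\mathbb{E}\left[u_0(X_0)+t\gamma_0(X_0)\,\middle|\,X_t\right],\qquad \gamma(X_t,t)=\mathbb{E}\left[\gamma_0(X_0)\,\middle|\,X_t\right].$$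
   Context: Accelerated sticky particle dynamics. There are $N$ particles with initial positions $x_1<\cdots<x_N$ in $\mathbb{R}$, masses $m_j>0$, initial velocities $v_j\in\mathbb{R}$ and initial accelerations $\theta_j\in\mathbb{R}$. Put $P_0=\sum_j m_j\delta_{x_j}$, $u_0(x_j)=v_j$, $\gamma_0(x_j)=\theta_j$. Each particle moves with constant acceleration until it collides; colliding particles stick together, with conservation of mass, momentum and force. Explicitly: for a nonempty set $G\subset\{x_1,\dots,x_N\}$ put $$c_G(t)=\frac{\sum_{x_j\in G}m_j\left(x_j+tv_j+\frac{t^2}{2}\theta_j\right)}{\sum_{x_j\in G}m_j}.$$ At time $0$ the partition $\xi_0$ of $\{x_1,\dots,x_N\}$ consists of the singletons. Let $s_0=0$. Given the partition $\xi_{s_k}$ at time $s_k$, the next shock time $s_{k+1}$ is the infimum of the times $t>s_k$ at which two distinct elements $G\ne G'$ of $\xi_{s_k}$ satisfy $c_G(t)=c_{G'}(t)$ ($s_{k+1}=+\infty$ if there is none). For $t\in[s_k,s_{k+1})$, $\xi_t=\xi_{s_k}$. At time $s_{k+1}$ all elements of $\xi_{s_k}$ having the same position $c_G(s_{k+1})$ are merged into one, which gives $\xi_{s_{k+1}}$. There are at most $N-1$ shock times. The elements of $\xi_t$ are called the clusters at time $t$. Flow. For $x_i$ in the cluster $G\in\xi_t$, set $$\phi(x_i,t)=c_G(t),\quad v(x_i,t)=\frac{\int_G\left(u_0(\eta)+t\gamma_0(\eta)\right)dP_0(\eta)}{P_0(G)},\quad \theta(x_i,t)=\frac{\int_G\gamma_0(\eta)\,dP_0(\eta)}{P_0(G)}.$$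 Since distinct clusters at time $t$ have distinct positions, there are functions $u,\gamma$ with $v(x_i,t)=u(\phi(x_i,t),t)$ and $\theta(x_i,t)=\gamma(\phi(x_i,t),t)$ for all $i$ and $t$. *)

theory Defs
  imports "HOL-Probability.Probability"
begin

(* Quantifying over finite families of non-overlapping subintervals of I. *)
definition absolutely_continuous_on :: "real set \<Rightarrow> (real \<Rightarrow> real) \<Rightarrow> bool" where
  "absolutely_continuous_on I f \<longleftrightarrow>
    (\<forall>\<epsilon>>0. \<exists>\<delta>>0. \<forall>(n::nat) a b.
      (\<forall>k<n. a k \<le> b k \<and> {a k..b k} \<subseteq> I) \<and>
      (\<forall>k<n. \<forall>l<n. k \<noteq> l \<longrightarrow> {a k<..<b k} \<inter> {a l<..<b l} = {}) \<and>
      (\<Sum>k<n. b k - a k) < \<delta>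
      \<longrightarrow> (\<Sum>k<n. \<bar>f (b k) - f (a k)\<bar>) < \<epsilon>)"

definition cadlag_on :: "real set \<Rightarrow> (real \<Rightarrow> real) \<Rightarrow> bool" where
  "cadlag_on I f \<longleftrightarrow>
    (\<forall>t\<in>I. continuous (at_right t) f \<and> (\<exists>l. (f \<longlongrightarrow> l) (at_left t)))"

(* The data: N particles, the j-th one (j = 1, ..., N) having initial position x j, mass m j,
   initial velocity v j and initial acceleration \<theta> j.  The conditions on the data (x strictly
   increasing, masses positive, ...) are not built into the definitions. *)
context
  fixes N :: nat and x m v \<theta> :: "nat \<Rightarrow> real"
begin

definition sites :: "real set" where
  "sites = x ` {1..N}"

(* The sum of the point masses m j at x j, as the image of the measure with weights m on {1..N}. *)
definition init_mass :: "real measure" where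
  "init_mass = distr (point_measure {1..N} (\<lambda>j. ennreal (m j))) borel x"

(* For distinct x 1, ..., x N, the function with value w j at x j, extended by 0 off the sites
   (a null set of init_mass) so that it is Borel measurable on the whole line. *)
definition init_fun :: "(nat \<Rightarrow> real) \<Rightarrow> real \<Rightarrow> real" where
  "init_fun w y = (\<Sum>j\<in>{1..N}. if x j = y then w j else 0)"

definition cluster_pos :: "real set \<Rightarrow> real \<Rightarrow> real" where
  "cluster_pos G t =
    (\<Sum>j | j \<in> {1..N} \<and> x j \<in> G. m j * (x j + t * v j + t\<^sup>2 / 2 * \<theta> j)) /
    (\<Sum>j | j \<in> {1..N} \<and> x j \<in> G. m j)"

definition merge :: "real \<Rightarrow> real set set \<Rightarrow> real set set" where
  "merge t P = {\<Union>{G' \<in> P. cluster_pos G' t = cluster_pos G t} | G. G \<in> P}"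

definition next_shock :: "ereal \<Rightarrow> real set set \<Rightarrow> ereal" where
  "next_shock s P = Inf {ereal t | t. s < ereal t \<and>
     (\<exists>G\<in>P. \<exists>G'\<in>P. G \<noteq> G' \<and> cluster_pos G t = cluster_pos G' t)}"

(* shock k is the k-th shock time together with the partition at that time.  As Inf {} = \<infinity> in
   ereal, the shock times are \<infinity> from the first missing shock on; the partition is then kept
   unchanged. *)
primrec shock :: "nat \<Rightarrow> ereal \<times> real set set" where
  "shock 0 = (0, (\<lambda>y. {y}) ` sites)"
| "shock (Suc k) =
    (let s = fst (shock k); P = snd (shock k); s' = next_shock s P
     in (s', if s' = \<infinity> then P else merge (real_of_ereal s') P))"

definition clusters :: "real \<Rightarrow> real set set" where
  "clusters t =
    snd (shock (THE k. fst (shock k) \<le> ereal t \<and> ereal t < fst (shock (Suc k))))"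

definition cluster_of :: "real \<Rightarrow> real \<Rightarrow> real set" where
  "cluster_of y t = (THE G. G \<in> clusters t \<and> y \<in> G)"

(* Off the sites, where no mass starts, the flow is (arbitrarily) the identity. *)
definition flow :: "real \<Rightarrow> real \<Rightarrow> real" where
  "flow y t = (if y \<in> sites then cluster_pos (cluster_of y t) t else y)"

definition flow_velocity :: "real \<Rightarrow> real \<Rightarrow> real" where
  "flow_velocity y t =
    (LINT \<eta>:cluster_of y t|init_mass. init_fun v \<eta> + t * init_fun \<theta> \<eta>) /
    measure init_mass (cluster_of y t)"

definition flow_acceleration :: "real \<Rightarrow> real \<Rightarrow> real" where
  "flow_acceleration y t =
    (LINT \<eta>:cluster_of y t|init_mass. init_fun \<theta> \<eta>) /
    measure init_mass (cluster_of y t)"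

(* The Eulerian fields: at a position z occupied at time t, the velocity and acceleration of a
   particle located there.  Distinct clusters have distinct positions, so all particles at z belong
   to one cluster and the choice is immaterial.  Values at unoccupied positions are irrelevant. *)
definition eulerian_velocity :: "real \<Rightarrow> real \<Rightarrow> real" where
  "eulerian_velocity z t = flow_velocity (SOME y. y \<in> sites \<and> flow y t = z) t"

definition eulerian_acceleration :: "real \<Rightarrow> real \<Rightarrow> real" where
  "eulerian_acceleration z t = flow_acceleration (SOME y. y \<in> sites \<and> flow y t = z) t"

end

end

(* Two distinct clusters of a partition with pairwise distinct positions move along distinct
   quadratic curves, so they meet only finitely often; hence shock times are attained, strictly
   increase, and each one lowers the number of clusters.  The cluster of a given particle is
   therefore locally constant to the right of every time, and constant just before it, and merging
   preserves centres of mass.  This gives the one-sided derivatives and limits, and a Lipschitz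
   bound for the paths.  A cluster at time t is an atom of the sigma-algebra generated by X_t, so
   conditional expectations given X_t are cluster averages. *)

theory Submission
  imports Defs
begin

text \<open>Position, velocity, acceleration and conditional expectation are all one linear
  operation, the mass-weighted average \<open>mean G w\<close> over a cluster, applied to different
  particle data \<open>w\<close>; this is why the formulas of the theorem match. The recursion
  carries one invariant: the clusters form a partition with distinct positions at the latest shock.
  Distinctness at a single instant already separates two parabolas for good, and a merge restores
  it. The count of clusters then bounds the number of finite shock times, which makes the
  description in \<open>clusters\<close> well defined. Two obstacles remain. A particle changes its
  parabola at shocks, so the Lipschitz bound is proved near each time and glued by bisection,
  without tracking the shock intervals. And a conditional expectation is fixed only up to a null set
  for each of uncountably many \<open>t\<close>; its value is nevertheless forced at every outcome
  that starts at a site, because every version is constant on the level sets of X_t and such a level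
  set has positive probability.\<close>

locale sticky_particles =
  fixes N :: nat and x m v \<theta> :: "nat \<Rightarrow> real"
  assumes inj_x: "inj_on x {1..N}"
    and m_pos: "j \<in> {1..N} \<Longrightarrow> 0 < m j"
begin

abbreviation "S \<equiv> sites N x"
abbreviation "pos \<equiv> cluster_pos N x m v \<theta>"
abbreviation "shock_seq \<equiv> shock N x m v \<theta>"
abbreviation "shock_after \<equiv> next_shock N x m v \<theta>"
abbreviation "merge_at \<equiv> merge N x m v \<theta>"
abbreviation "clusters_at \<equiv> clusters N x m v \<theta>"
abbreviation "cluster_at \<equiv> cluster_of N x m v \<theta>"
abbreviation "traj \<equiv> flow N x m v \<theta>"

section \<open>Mass-weighted averages over sets of particles\<close>

definition mass :: "real set \<Rightarrow> real" where
  "mass G = (\<Sum>j | j \<in> {1..N} \<and> x j \<in> G. m j)"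

text \<open>Data are indexed by particles, not by positions, so that \<open>w\<close> can be the
  positions, velocities, accelerations or any combination of them; linearity in \<open>w\<close>
  then yields every kinematic formula.\<close>

definition mean :: "real set \<Rightarrow> (nat \<Rightarrow> real) \<Rightarrow> real" where
  "mean G w = (\<Sum>j | j \<in> {1..N} \<and> x j \<in> G. m j * w j) / mass G"

lemma finite_sites: "finite S"
  by (simp add: sites_def)

lemma mass_pos:
  assumes "G \<subseteq> S" "G \<noteq> {}"
  shows "0 < mass G"
proof -
  obtain j where "j \<in> {1..N}" "x j \<in> G"
    using assms by (force simp: sites_def)
  then show ?thesis
    unfolding mass_def by (intro sum_pos) (auto intro: m_pos)
qed

lemma mean_add: "mean G (\<lambda>j. w j + w' j) = mean G w + mean G w'"
  by (simp add: mean_def distrib_left sum.distrib add_divide_distrib)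

lemma mean_scale: "mean G (\<lambda>j. c * w j) = c * mean G w"
  by (simp add: mean_def sum_distrib_left mult.left_commute)

lemma pos_mean: "pos G t = mean G (\<lambda>j. x j + t * v j + t\<^sup>2 / 2 * \<theta> j)"
  by (simp add: cluster_pos_def mean_def mass_def)

lemma pos_quadratic: "pos G t = mean G x + t * mean G v + t\<^sup>2 / 2 * mean G \<theta>"
  by (simp only: pos_mean mean_add mean_scale)

text \<open>Disjointness splits numerator and denominator block by block, and an average of averages
  equal to \<open>c\<close> is again \<open>c\<close>. With \<open>w\<close> the free-flight
  positions at time \<open>t\<close> this is conservation of the centre of mass under
  merging.\<close>

lemma mean_Union_eq:
  assumes "finite Q" "Q \<noteq> {}" "disjoint Q" "\<And>G. G \<in> Q \<Longrightarrow> G \<subseteq> S \<and> G \<noteq> {} \<and> mean G w = c"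
  shows "mean (\<Union>Q) w = c"
proof -
  let ?I = "\<lambda>G. {j. j \<in> {1..N} \<and> x j \<in> G}"
  have *: "(\<Sum>j\<in>?I (\<Union>Q). f j) = (\<Sum>G\<in>Q. \<Sum>j\<in>?I G. f j)" for f :: "nat \<Rightarrow> real"
  proof -
    have "?I (\<Union>Q) = (\<Union>G\<in>Q. ?I G)"
      by auto
    moreover have "(\<Sum>j\<in>(\<Union>G\<in>Q. ?I G). f j) = (\<Sum>G\<in>Q. \<Sum>j\<in>?I G. f j)"
      using assms(1,3) by (intro sum.UNION_disjoint) (auto simp: disjoint_def)
    ultimately show ?thesis by simp
  qed
  have "(\<Sum>j\<in>?I G. m j * w j) = c * mass G" if "G \<in> Q" for G
    using mass_pos[of G] assms(4)[OF that] by (auto simp: mean_def field_simps)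
  then have "(\<Sum>j\<in>?I (\<Union>Q). m j * w j) = c * mass (\<Union>Q)"
    unfolding mass_def * by (simp add: sum_distrib_left)
  moreover have "0 < mass (\<Union>Q)"
    using assms(2,4) by (intro mass_pos) auto
  ultimately show ?thesis by (simp add: mean_def)
qed

lemma pos_Union_eq:
  assumes "partition_on S P" "G \<in> P"
  shows "pos (\<Union>{G' \<in> P. pos G' t = pos G t}) t = pos G t"
proof -
  have "finite P" using assms(1) finite_sites finite_elements by blast
  then have "mean (\<Union>{G' \<in> P. pos G' t = pos G t}) (\<lambda>j. x j + t * v j + t\<^sup>2 / 2 * \<theta> j) = pos G t"
    using assms by (intro mean_Union_eq) (auto simp: partition_on_def disjoint_def pos_mean)
  then show ?thesis by (simp add: pos_mean)
qed

section \<open>Effect of a merge on a partition\<close>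

lemma partition_merge:
  assumes "partition_on S P"
  shows "partition_on S (merge_at t P)"
proof (rule partition_onI)
  have P: "\<Union>P = S" "disjoint P" "{} \<notin> P"
    using assms by (auto simp: partition_on_def)
  show "{} \<notin> merge_at t P"
    using P(3) unfolding merge_def by fastforce
  show "\<Union>(merge_at t P) = S"
    using P(1) unfolding merge_def by blast
  show "disjnt p q" if pq: "p \<in> merge_at t P" "q \<in> merge_at t P" "p \<noteq> q" for p q
  proof -
    obtain G H where G: "G \<in> P" "p = \<Union>{G' \<in> P. pos G' t = pos G t}"
      and H: "H \<in> P" "q = \<Union>{G' \<in> P. pos G' t = pos H t}"
      using pq by (auto simp: merge_def)
    then have "pos G t \<noteq> pos H t" using pq(3) by auto
    then show ?thesis
      using P(2) unfolding disjnt_def G(2) H(2) disjoint_def by fastforce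
  qed
qed

text \<open>A merged block sits at the common position of its constituents, so blocks at the same
  position come from the same fibre of the position map. This restores the distinctness that a shock
  destroys.\<close>

lemma inj_on_pos_merge:
  assumes "partition_on S P"
  shows "inj_on (\<lambda>G. pos G t) (merge_at t P)"
proof (rule inj_onI)
  fix p q assume pq: "p \<in> merge_at t P" "q \<in> merge_at t P" "pos p t = pos q t"
  then obtain G H where G: "G \<in> P" "p = \<Union>{G' \<in> P. pos G' t = pos G t}"
    and H: "H \<in> P" "q = \<Union>{G' \<in> P. pos G' t = pos H t}"
    by (auto simp: merge_def)
  have "pos G t = pos H t"
    using pq(3) pos_Union_eq[OF assms G(1), of t] pos_Union_eq[OF assms H(1), of t] G(2) H(2) by simp
  then show "p = q" using G(2) H(2) by simp
qed

text \<open>The source of continuity across a shock: a cluster entering the merge arrives exactly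
  where the cluster absorbing it starts.\<close>

lemma merge_refines:
  assumes "partition_on S P" "G \<in> P"
  shows "\<exists>H\<in>merge_at t P. G \<subseteq> H \<and> pos G t = pos H t"
  using assms pos_Union_eq[OF assms, of t]
  by (intro bexI[of _ "\<Union>{G' \<in> P. pos G' t = pos G t}"]) (auto simp: merge_def)

text \<open>The merge is the image of \<open>P\<close> under a map that identifies \<open>G\<close>
  and \<open>G'\<close>, so it has strictly fewer elements.\<close>

lemma card_merge_less:
  assumes "finite P" "G \<in> P" "G' \<in> P" "G \<noteq> G'" "pos G t = pos G' t"
  shows "card (merge_at t P) < card P"
proof -
  let ?f = "\<lambda>G. \<Union>{G' \<in> P. pos G' t = pos G t}"
  have eq: "merge_at t P = ?f ` P" by (auto simp: merge_def)
  have "?f G = ?f G'" using assms(5) by simp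
  then have "\<not> inj_on ?f P" using assms(2-4) by (auto dest: inj_onD)
  then show ?thesis
    unfolding eq using assms(1) card_image_le[of P ?f] eq_card_imp_inj_on[of P ?f] by linarith
qed

section \<open>Meeting times and the shock sequence\<close>

lemma finite_pos_coincidence:
  assumes "pos G s \<noteq> pos H s"
  shows "finite {t. pos G t = pos H t}"
proof -
  \<comment> \<open>The difference of the two parabolas as a polynomial; it is not zero because its
    value at \<open>s\<close> is not zero.\<close>
  let ?p = "[:mean G x - mean H x, mean G v - mean H v, (mean G \<theta> - mean H \<theta>) / 2:]"
  have p: "poly ?p t = pos G t - pos H t" for t
    by (simp add: pos_quadratic power2_eq_square field_simps)
  then have "?p \<noteq> 0" using assms by (metis eq_iff_diff_eq_0 poly_0)
  then have "finite {t. poly ?p t = 0}" by (rule poly_roots_finite)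
  then show ?thesis unfolding p by simp
qed

text \<open>A coincidence at a time in \<open>(s, t]\<close> would belong to the set whose infimum
  is the next shock.\<close>

lemma inj_on_pos_before_next_shock:
  assumes "inj_on (\<lambda>G. pos G s) P" "s \<le> t" "ereal t < shock_after (ereal s) P"
  shows "inj_on (\<lambda>G. pos G t) P"
proof (cases "s = t")
  case False
  show ?thesis
  proof (rule inj_onI, rule ccontr)
    fix G H assume "G \<in> P" "H \<in> P" "pos G t = pos H t" "G \<noteq> H"
    then have "shock_after (ereal s) P \<le> ereal t"
      unfolding next_shock_def using False assms(2) by (intro Inf_lower) auto
    then show False using assms(3) by simp
  qed
qed (use assms in auto)

text \<open>There are finitely many pairs of clusters and each pair meets finitely often, so the
  infimum is over a finite set: it is a minimum, attained by some pair after \<open>s\<close>, or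
  \<infinity> if the set is empty.\<close>

lemma next_shock_cases:
  assumes "inj_on (\<lambda>G. pos G s) P" "finite P"
  obtains "shock_after (ereal s) P = \<infinity>"
  | t G H where "shock_after (ereal s) P = ereal t" "s < t" "G \<in> P" "H \<in> P" "G \<noteq> H" "pos G t = pos H t"
proof -
  define A where "A = {t. s < t \<and> (\<exists>G\<in>P. \<exists>H\<in>P. G \<noteq> H \<and> pos G t = pos H t)}"
  have eq: "shock_after (ereal s) P = Inf (ereal ` A)"
    unfolding next_shock_def A_def by (rule arg_cong[of _ _ Inf]) auto
  have "finite {t. pos G t = pos H t}" if "G \<in> P" "H \<in> P" "G \<noteq> H" for G H
    using that assms(1) by (intro finite_pos_coincidence[of _ s]) (auto simp: inj_on_def)
  moreover have "A \<subseteq> (\<Union>G\<in>P. \<Union>H\<in>P - {G}. {t. pos G t = pos H t})"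
    by (auto simp: A_def)
  ultimately have fin: "finite (ereal ` A)"
    using assms(2) by (intro finite_imageI) (auto intro!: finite_subset[of A])
  show thesis
  proof (cases "A = {}")
    case True
    then show thesis using that(1) eq by (simp add: top_ereal_def)
  next
    case False
    then have "Inf (ereal ` A) \<in> ereal ` A"
      using fin Min_in[of "ereal ` A"] by (simp add: Min_Inf)
    then show thesis using that(2) eq by (auto simp: A_def)
  qed
qed

lemma shock_time_mono: "fst (shock_seq k) \<le> fst (shock_seq (Suc k))"
  unfolding shock.simps(2) next_shock_def by (auto simp: Let_def intro!: Inf_greatest)

lemma shock_time_nonneg: "0 \<le> fst (shock_seq k)"
proof (induction k)
  case (Suc k)
  then show ?case using shock_time_mono[of k] by (rule order_trans)
qed simp

text \<open>The conjuncts support each other: distinct positions make the next shock attained, an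
  attained shock lowers the number of clusters, and the merge makes positions distinct again. The
  shock time must be finite: once it is \<infinity>, the partition is frozen while \<open>k\<close>
  keeps growing, so the last conjunct would eventually fail.\<close>

lemma shock_invariant:
  assumes "fst (shock_seq k) = ereal s"
  shows "0 \<le> s \<and> partition_on S (snd (shock_seq k)) \<and> inj_on (\<lambda>G. pos G s) (snd (shock_seq k))
    \<and> card (snd (shock_seq k)) + k \<le> N"
  using assms
proof (induction k arbitrary: s)
  case 0
  \<comment> \<open>As \<open>x\<close> is injective, a singleton contains exactly one particle,
    whose mass cancels in the quotient.\<close>
  have pos0: "pos {x j} 0 = x j" if "j \<in> {1..N}" for j
  proof -
    have "{i. i \<in> {1..N} \<and> x i \<in> {x j}} = {j}"
      using that inj_onD[OF inj_x, of _ j] by blast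
    then show ?thesis using m_pos[OF that] by (simp only: cluster_pos_def) simp
  qed
  have "card S \<le> N" using card_image_le[of "{1..N}" x] by (simp add: sites_def)
  then have "card ((\<lambda>y. {y}) ` S) \<le> N"
    using card_image_le[OF finite_sites, of "\<lambda>y. {y}"] by linarith
  moreover have "inj_on (\<lambda>G. pos G 0) ((\<lambda>y. {y}) ` S)"
  proof (rule inj_onI)
    fix G H assume *: "G \<in> (\<lambda>y. {y}) ` S" "H \<in> (\<lambda>y. {y}) ` S" "pos G 0 = pos H 0"
    then obtain i j where "i \<in> {1..N}" "G = {x i}" "j \<in> {1..N}" "H = {x j}"
      unfolding sites_def by blast
    then show "G = H" using *(3) pos0 by simp
  qed
  moreover have "partition_on S ((\<lambda>y. {y}) ` S)"
    by (auto simp: partition_on_def disjoint_def)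
  moreover have "s = 0" using 0 by (simp add: zero_ereal_def)
  ultimately show ?case by simp
next
  case (Suc k)
  let ?P = "snd (shock_seq k)"
  have s: "shock_after (fst (shock_seq k)) ?P = ereal s"
    using Suc.prems by (simp add: Let_def)
  \<comment> \<open>No real time exceeds \<infinity>, so a predecessor at \<infinity> would give an
    empty infimum, which is not the finite \<open>s\<close>.\<close>
  then have "fst (shock_seq k) \<noteq> \<infinity>" by (auto simp: next_shock_def top_ereal_def)
  moreover have "fst (shock_seq k) \<noteq> -\<infinity>"
    using shock_time_nonneg[of k] by auto
  ultimately obtain s0 where s0: "fst (shock_seq k) = ereal s0"
    by (cases "fst (shock_seq k)") auto
  note IH = Suc.IH[OF s0]
  have fin: "finite ?P" using IH finite_sites finite_elements by blast
  have s': "shock_after (ereal s0) ?P = ereal s" using s s0 by simp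
  obtain G H where *: "s0 < s" "G \<in> ?P" "H \<in> ?P" "G \<noteq> H" "pos G s = pos H s"
    by (rule next_shock_cases[of s0 ?P]) (use IH fin s' in auto)
  have eq: "snd (shock_seq (Suc k)) = merge_at s ?P" using s by (simp add: Let_def)
  have "0 \<le> s" using IH *(1) by linarith
  moreover have "card (merge_at s ?P) + Suc k \<le> N"
    using IH card_merge_less[OF fin *(2-5)] by linarith
  ultimately show ?case
    unfolding eq using IH partition_merge inj_on_pos_merge by blast
qed

section \<open>The partition as a function of time\<close>

lemma incseq_shock_time: "incseq (\<lambda>k. fst (shock_seq k))"
  using shock_time_mono by (rule incseq_SucI)

text \<open>Since shock times are monotone, the half-open intervals between consecutive ones are
  disjoint; the index described in \<open>clusters\<close> is therefore unique.\<close>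

lemma clusters_eq:
  assumes "fst (shock_seq k) \<le> ereal t" "ereal t < fst (shock_seq (Suc k))"
  shows "clusters_at t = snd (shock_seq k)"
proof -
  have "j = k" if j: "fst (shock_seq j) \<le> ereal t" "ereal t < fst (shock_seq (Suc j))" for j
  proof (rule ccontr)
    assume "j \<noteq> k"
    then consider "Suc j \<le> k" | "Suc k \<le> j" by linarith
    then show False
      using j assms incseqD[OF incseq_shock_time, of "Suc j" k]
        incseqD[OF incseq_shock_time, of "Suc k" j]
      by cases (auto simp del: shock.simps)
  qed
  then have "(THE k. fst (shock_seq k) \<le> ereal t \<and> ereal t < fst (shock_seq (Suc k))) = k"
    using assms by (intro the_equality) blast+
  then show ?thesis unfolding clusters_def by (simp del: shock.simps)
qed

text \<open>A finite time at index \<open>Suc N\<close> would contradict the bound on the number of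
  clusters plus the index.\<close>

lemma shock_time_eventually_infinite: "fst (shock_seq (Suc N)) = \<infinity>"
proof (rule ccontr)
  assume *: "fst (shock_seq (Suc N)) \<noteq> \<infinity>"
  obtain s where "fst (shock_seq (Suc N)) = ereal s"
    using * shock_time_nonneg[of "Suc N"]
    by (cases "fst (shock_seq (Suc N))") (auto simp del: shock.simps)
  then show False using shock_invariant[of "Suc N" s] by linarith
qed

lemma shock_interval:
  assumes "0 \<le> t"
  obtains k s where "fst (shock_seq k) = ereal s" "0 \<le> s" "s \<le> t"
    "ereal t < fst (shock_seq (Suc k))"
    "partition_on S (snd (shock_seq k))" "inj_on (\<lambda>G. pos G s) (snd (shock_seq k))"
    "shock_after (ereal s) (snd (shock_seq k)) = fst (shock_seq (Suc k))"
proof -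
  \<comment> \<open>The least index whose shock time exceeds \<open>t\<close>. It exists because
    index \<open>Suc N\<close> qualifies, and it is not 0 because the sequence starts at time 0; its
    predecessor is the index sought.\<close>
  define K where "K = (LEAST k. ereal t < fst (shock_seq k))"
  have K: "ereal t < fst (shock_seq K)"
    unfolding K_def by (rule LeastI[of _ "Suc N"]) (simp only: shock_time_eventually_infinite less_ereal.simps)
  moreover have "\<not> ereal t < fst (shock_seq 0)" using assms by (simp add: zero_ereal_def)
  ultimately obtain k where k: "K = Suc k" by (cases K) auto
  have le: "fst (shock_seq k) \<le> ereal t"
    using not_less_Least[of k "\<lambda>k. ereal t < fst (shock_seq k)"] k unfolding K_def[symmetric]
    by (simp add: not_less)
  obtain s where s: "fst (shock_seq k) = ereal s"
    using le shock_time_nonneg[of k] by (cases "fst (shock_seq k)") auto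
  show thesis
  proof (rule that[OF s])
    show "shock_after (ereal s) (snd (shock_seq k)) = fst (shock_seq (Suc k))"
      using s by (simp add: Let_def)
  qed (use shock_invariant[OF s] le s K k in \<open>auto simp del: shock.simps\<close>)
qed

lemma clusters_partition:
  assumes "0 \<le> t"
  shows "partition_on S (clusters_at t)" and "inj_on (\<lambda>G. pos G t) (clusters_at t)"
proof -
  obtain k s where k: "fst (shock_seq k) = ereal s" "s \<le> t" "ereal t < fst (shock_seq (Suc k))"
    "partition_on S (snd (shock_seq k))" "inj_on (\<lambda>G. pos G s) (snd (shock_seq k))"
    "shock_after (ereal s) (snd (shock_seq k)) = fst (shock_seq (Suc k))"
    by (rule shock_interval[OF assms]) (rule that)
  have eq: "clusters_at t = snd (shock_seq k)"
    using k(1-3) by (intro clusters_eq) (simp_all del: shock.simps)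
  show "partition_on S (clusters_at t)" unfolding eq by (rule k)
  show "inj_on (\<lambda>G. pos G t) (clusters_at t)"
    unfolding eq using k(3) by (intro inj_on_pos_before_next_shock[OF k(5,2)]) (simp only: k(6))
qed

lemma eventually_clusters_eq:
  assumes "fst (shock_seq k) \<le> ereal a" "ereal b \<le> fst (shock_seq (Suc k))"
  shows "a < b \<Longrightarrow> \<forall>\<^sub>F s in at_right a. clusters_at s = snd (shock_seq k)"
    and "a < b \<Longrightarrow> \<forall>\<^sub>F s in at_left b. clusters_at s = snd (shock_seq k)"
proof -
  have *: "clusters_at s = snd (shock_seq k)" if "a < s" "s < b" for s
  proof (rule clusters_eq)
    show "fst (shock_seq k) \<le> ereal s"
      using assms(1) by (rule order_trans) (use that in simp)
    show "ereal s < fst (shock_seq (Suc k))"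
      using assms(2) that by (metis less_le_trans less_ereal.simps(1))
  qed
  show "a < b \<Longrightarrow> \<forall>\<^sub>F s in at_right a. clusters_at s = snd (shock_seq k)"
    using * by (auto simp: eventually_at_right)
  show "a < b \<Longrightarrow> \<forall>\<^sub>F s in at_left b. clusters_at s = snd (shock_seq k)"
    using * by (auto simp: eventually_at_left)
qed

lemma clusters_right:
  assumes "0 \<le> t"
  shows "\<forall>\<^sub>F s in at_right t. clusters_at s = clusters_at t"
proof -
  obtain k s where k: "fst (shock_seq k) = ereal s" "s \<le> t" "ereal t < fst (shock_seq (Suc k))"
    using assms by (rule shock_interval)
  then have le: "fst (shock_seq k) \<le> ereal t" by simp
  \<comment> \<open>The next shock time may be \<infinity>, so a real bound below it is
    chosen.\<close>
  obtain b where "t < b" "ereal b \<le> fst (shock_seq (Suc k))"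
    using ereal_dense2[OF k(3)] by (metis less_ereal.simps(1) less_imp_le)
  then show ?thesis
    using eventually_clusters_eq(1)[OF le] clusters_eq[OF le k(3)] by (simp del: shock.simps)
qed

text \<open>At a shock time \<open>P\<close> is the partition before the merge, otherwise it is the
  current one. Refinement with equal positions at time \<open>t\<close> covers both cases.\<close>

lemma clusters_left:
  assumes "0 < t"
  obtains P where "\<forall>\<^sub>F s in at_left t. clusters_at s = P" "partition_on S P"
    "\<And>G. G \<in> P \<Longrightarrow> \<exists>H\<in>clusters_at t. G \<subseteq> H \<and> pos G t = pos H t"
proof -
  have "0 \<le> t" using assms by simp
  then obtain k s where k: "fst (shock_seq k) = ereal s" "0 \<le> s" "s \<le> t"
    "ereal t < fst (shock_seq (Suc k))"
    by (rule shock_interval)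
  then have le: "fst (shock_seq k) \<le> ereal t" by simp
  have part: "partition_on S (clusters_at t)" using assms by (intro clusters_partition) simp
  show thesis
  proof (cases "s < t")
    case True
    then have "\<forall>\<^sub>F r in at_left t. clusters_at r = clusters_at t"
      using eventually_clusters_eq(2)[of k s t] k clusters_eq[OF le k(4)]
      by (simp del: shock.simps)
    then show thesis using that part by blast
  next
    case False
    then have st: "s = t" using k by simp
    \<comment> \<open>Here \<open>t\<close> is itself a shock time; being positive it is not the
      initial one, so a preceding partition exists.\<close>
    obtain j where j: "k = Suc j"
    proof (cases k)
      case 0
      then show thesis using k(1) assms st by (simp add: zero_ereal_def)
    qed
    let ?P = "snd (shock_seq j)"
    have t: "fst (shock_seq (Suc j)) = ereal t" using k st j by (simp del: shock.simps)
    have jn: "shock_after (fst (shock_seq j)) ?P = ereal t" using t by (simp add: Let_def)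
    then have "fst (shock_seq j) \<noteq> \<infinity>" by (auto simp: next_shock_def top_ereal_def)
    then obtain a where a: "fst (shock_seq j) = ereal a"
      using shock_time_nonneg[of j] by (cases "fst (shock_seq j)") auto
    note inv = shock_invariant[OF a]
    have "finite ?P" using inv finite_sites finite_elements by blast
    then have "ereal a < shock_after (ereal a) ?P"
      using inv next_shock_cases[of a ?P "ereal a < shock_after (ereal a) ?P"] by auto
    then have "a < t" using jn a by simp
    then have "\<forall>\<^sub>F r in at_left t. clusters_at r = ?P"
      using eventually_clusters_eq(2)[of j a t] a t by (simp del: shock.simps)
    moreover have "clusters_at t = merge_at t ?P"
      using clusters_eq[OF le k(4)] jn unfolding j by (simp add: Let_def)
    ultimately show thesis
      using that[of ?P] inv merge_refines[of ?P _ t] by auto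
  qed
qed

section \<open>The cluster of a single particle\<close>

lemma cluster_of_eqI:
  assumes "partition_on S (clusters_at t)" "G \<in> clusters_at t" "y \<in> G"
  shows "cluster_at y t = G"
  unfolding cluster_of_def
proof (rule the_equality)
  fix H assume "H \<in> clusters_at t \<and> y \<in> H"
  then show "H = G"
    using assms disjointD[of "clusters_at t" H G] unfolding partition_on_def by blast
qed (use assms in blast)

lemma cluster_of_in:
  assumes "0 \<le> t" "y \<in> S"
  shows "cluster_at y t \<in> clusters_at t" and "y \<in> cluster_at y t"
proof -
  have P: "partition_on S (clusters_at t)" using assms(1) by (rule clusters_partition)
  then obtain G where "G \<in> clusters_at t" "y \<in> G"
    using assms(2) by (auto simp: partition_on_def)
  then show "cluster_at y t \<in> clusters_at t" "y \<in> cluster_at y t"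
    using cluster_of_eqI[OF P] by auto
qed

lemma cluster_of_subset: "0 \<le> t \<Longrightarrow> y \<in> S \<Longrightarrow> cluster_at y t \<subseteq> S"
  using cluster_of_in(1)[of t y] clusters_partition(1)[of t] unfolding partition_on_def by blast

lemma cluster_of_right:
  assumes "0 \<le> t" "y \<in> S"
  shows "\<forall>\<^sub>F s in at_right t. 0 \<le> s \<and> cluster_at y s = cluster_at y t"
proof -
  have "\<forall>\<^sub>F s in at_right t. t < s" by (simp add: eventually_at_right_less)
  with clusters_right[OF assms(1)] show ?thesis
    by eventually_elim (use assms in \<open>auto simp: cluster_of_def\<close>)
qed

lemma cluster_of_left:
  assumes "0 < t" "y \<in> S"
  obtains G where "G \<subseteq> S" "\<forall>\<^sub>F s in at_left t. 0 \<le> s \<and> cluster_at y s = G" "pos G t = pos (cluster_at y t) t"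
proof -
  obtain P where P: "\<forall>\<^sub>F s in at_left t. clusters_at s = P" "partition_on S P"
    "\<And>G. G \<in> P \<Longrightarrow> \<exists>H\<in>clusters_at t. G \<subseteq> H \<and> pos G t = pos H t"
    using clusters_left[OF assms(1)] by blast
  obtain G where G: "G \<in> P" "y \<in> G" using P(2) assms(2) by (auto simp: partition_on_def)
  obtain H where H: "H \<in> clusters_at t" "G \<subseteq> H" "pos G t = pos H t" using P(3)[OF G(1)] by blast
  have "cluster_at y t = H"
    using assms H G by (intro cluster_of_eqI clusters_partition) auto
  moreover have "\<forall>\<^sub>F s in at_left t. 0 < s"
    using assms(1) by (intro order_tendstoD(1)[OF tendsto_ident_at])
  then have "\<forall>\<^sub>F s in at_left t. 0 \<le> s \<and> cluster_at y s = G"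
    using P(1) by eventually_elim (use P(2) G in \<open>simp add: cluster_of_eqI\<close>)
  moreover have "G \<subseteq> S" using P(2) G by (auto simp: partition_on_def)
  ultimately show thesis using that H(3) by blast
qed

text \<open>Distinct clusters have distinct positions at every time, not only at shocks. This makes
  the Eulerian fields well defined and identifies the level sets of the flow among the sites with
  clusters.\<close>

lemma flow_eq_iff:
  assumes "0 \<le> t" "y \<in> S" "z \<in> S"
  shows "traj y t = traj z t \<longleftrightarrow> cluster_at y t = cluster_at z t"
proof -
  note P = cluster_of_in(1)[OF assms(1,2)] cluster_of_in(1)[OF assms(1,3)]
  have "traj y t = pos (cluster_at y t) t" "traj z t = pos (cluster_at z t) t"
    using assms by (simp_all only: flow_def if_True)
  then show ?thesis
    using inj_on_eq_iff[OF clusters_partition(2)[OF assms(1)] P] by metis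
qed

section \<open>Integrals against the initial mass and Eulerian fields as cluster averages\<close>

lemma mean_cong: "(\<And>j. j \<in> {1..N} \<Longrightarrow> w j = w' j) \<Longrightarrow> mean G w = mean G w'"
  unfolding mean_def by (intro arg_cong2[of _ _ _ _ "(/)"] sum.cong) auto

lemma init_fun_site: "j \<in> {1..N} \<Longrightarrow> init_fun N x w (x j) = w j"
proof -
  assume j: "j \<in> {1..N}"
  have "init_fun N x w (x j) = (\<Sum>i\<in>{1..N}. if i = j then w i else 0)"
    unfolding init_fun_def using j by (intro sum.cong) (auto dest: inj_onD[OF inj_x])
  then show ?thesis using j by simp
qed

lemma init_fun_measurable [measurable]: "init_fun N x w \<in> borel_measurable borel"
  unfolding init_fun_def by measurable

lemma sets_init_mass [simp, measurable_cong]: "sets (init_mass N x m) = sets borel"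
  by (simp add: init_mass_def)

lemma init_mass_index_measurable: "x \<in> measurable (point_measure {1..N} (\<lambda>j. ennreal (m j))) borel"
  by simp

lemma integrable_init_mass:
  fixes f :: "real \<Rightarrow> real"
  assumes "f \<in> borel_measurable borel"
  shows "integrable (init_mass N x m) f"
  unfolding init_mass_def using m_pos
  by (subst integrable_distr_eq[OF init_mass_index_measurable assms])
    (intro integrable_point_measure_finite, auto)

lemma integral_init_mass:
  fixes f :: "real \<Rightarrow> real"
  assumes "f \<in> borel_measurable borel"
  shows "(LINT y|init_mass N x m. f y) = (\<Sum>j\<in>{1..N}. m j * f (x j))"
  unfolding init_mass_def using m_pos
  by (subst integral_distr[OF init_mass_index_measurable assms],
      subst lebesgue_integral_point_measure_finite) (auto simp: less_imp_le)

lemma set_integral_init_mass: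
  fixes f :: "real \<Rightarrow> real"
  assumes [measurable]: "f \<in> borel_measurable borel" "G \<in> sets borel"
  shows "(LINT y:G|init_mass N x m. f y) = (\<Sum>j | j \<in> {1..N} \<and> x j \<in> G. m j * f (x j))"
proof -
  have "(LINT y:G|init_mass N x m. f y) = (\<Sum>j\<in>{1..N}. m j * (indicator G (x j) * f (x j)))"
    unfolding set_lebesgue_integral_def by (subst integral_init_mass) auto
  also have "\<dots> = (\<Sum>j\<in>{1..N}. if x j \<in> G then m j * f (x j) else 0)"
    by (intro sum.cong) auto
  also have "\<dots> = (\<Sum>j | j \<in> {1..N} \<and> x j \<in> G. m j * f (x j))"
    by (rule sum.inter_filter[symmetric]) simp
  finally show ?thesis .
qed

lemma measure_init_mass:
  assumes [measurable]: "G \<in> sets borel"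
  shows "measure (init_mass N x m) G = mass G"
proof -
  have "measure (init_mass N x m) G = (LINT y:G|init_mass N x m. 1)"
    by (simp add: set_lebesgue_integral_def)
  then show ?thesis by (simp add: set_integral_init_mass mass_def)
qed

lemma borel_if_subset_sites: "G \<subseteq> S \<Longrightarrow> G \<in> sets borel"
  using finite_subset[OF _ finite_sites] by (intro borel_closed finite_imp_closed) auto

lemma mean_init_fun: "mean G (\<lambda>j. init_fun N x w (x j)) = mean G w"
  by (intro mean_cong init_fun_site)

lemma flow_velocity_eq:
  assumes "0 \<le> t" "y \<in> S"
  shows "flow_velocity N x m v \<theta> y t = mean (cluster_at y t) v + t * mean (cluster_at y t) \<theta>"
proof -
  have b: "cluster_at y t \<in> sets borel" using assms by (intro borel_if_subset_sites cluster_of_subset)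
  have "flow_velocity N x m v \<theta> y t =
      mean (cluster_at y t) (\<lambda>j. init_fun N x v (x j) + t * init_fun N x \<theta> (x j))"
    unfolding flow_velocity_def measure_init_mass[OF b] mean_def
    by (subst set_integral_init_mass) (use b in auto)
  then show ?thesis by (simp only: mean_add mean_scale mean_init_fun)
qed

lemma flow_acceleration_eq:
  assumes "0 \<le> t" "y \<in> S"
  shows "flow_acceleration N x m v \<theta> y t = mean (cluster_at y t) \<theta>"
proof -
  have b: "cluster_at y t \<in> sets borel" using assms by (intro borel_if_subset_sites cluster_of_subset)
  have "flow_acceleration N x m v \<theta> y t = mean (cluster_at y t) (\<lambda>j. init_fun N x \<theta> (x j))"
    unfolding flow_acceleration_def measure_init_mass[OF b] mean_def
    by (subst set_integral_init_mass) (use b in auto)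
  then show ?thesis by (simp only: mean_init_fun)
qed

text \<open>The particle picked by \<open>SOME\<close> shares its position with \<open>y\<close>,
  hence its cluster, and velocity and acceleration depend only on the cluster.\<close>

lemma eulerian_eq:
  assumes "0 \<le> t" "y \<in> S"
  shows eulerian_velocity_eq: "eulerian_velocity N x m v \<theta> (traj y t) t =
      mean (cluster_at y t) v + t * mean (cluster_at y t) \<theta>"
    and eulerian_acceleration_eq: "eulerian_acceleration N x m v \<theta> (traj y t) t =
      mean (cluster_at y t) \<theta>"
proof -
  define z where "z = (SOME z. z \<in> S \<and> traj z t = traj y t)"
  have z: "z \<in> S \<and> traj z t = traj y t"
    unfolding z_def by (rule someI[of _ y]) (simp add: assms(2))
  then have "cluster_at z t = cluster_at y t"
    using flow_eq_iff[OF assms(1), of z y] assms(2) by simp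
  then show "eulerian_velocity N x m v \<theta> (traj y t) t =
      mean (cluster_at y t) v + t * mean (cluster_at y t) \<theta>"
    "eulerian_acceleration N x m v \<theta> (traj y t) t = mean (cluster_at y t) \<theta>"
    using flow_velocity_eq[OF assms(1), of z] flow_acceleration_eq[OF assms(1), of z] z
    by (simp_all add: eulerian_velocity_def eulerian_acceleration_def z_def)
qed

section \<open>One-sided derivatives and limits\<close>

lemma flow_right_derivative:
  assumes "0 \<le> t" "y \<in> S"
  shows "((\<lambda>s. traj y s) has_real_derivative
    mean (cluster_at y t) v + t * mean (cluster_at y t) \<theta>) (at_right t)"
proof -
  let ?G = "cluster_at y t"
  have "\<forall>\<^sub>F s in at_right t. traj y s = pos ?G s"
    using cluster_of_right[OF assms] by eventually_elim (use assms in \<open>simp add: flow_def\<close>)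
  moreover have "traj y t = pos ?G t" using assms by (simp add: flow_def)
  moreover have "((\<lambda>s. pos ?G s) has_real_derivative mean ?G v + t * mean ?G \<theta>) (at_right t)"
    unfolding pos_quadratic by (auto intro!: derivative_eq_intros)
  ultimately show ?thesis
    by (subst has_field_derivative_cong_eventually) auto
qed

lemma eulerian_velocity_right_derivative:
  assumes "0 \<le> t" "y \<in> S"
  shows "((\<lambda>s. eulerian_velocity N x m v \<theta> (traj y s) s) has_real_derivative
    mean (cluster_at y t) \<theta>) (at_right t)"
proof -
  let ?G = "cluster_at y t"
  have "\<forall>\<^sub>F s in at_right t. eulerian_velocity N x m v \<theta> (traj y s) s = mean ?G v + s * mean ?G \<theta>"
    using cluster_of_right[OF assms]
    by eventually_elim (use assms in \<open>simp add: eulerian_velocity_eq\<close>)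
  moreover have "((\<lambda>s. mean ?G v + s * mean ?G \<theta>) has_real_derivative mean ?G \<theta>) (at_right t)"
    by (auto intro!: derivative_eq_intros)
  ultimately show ?thesis
    using assms by (subst has_field_derivative_cong_eventually) (auto simp: eulerian_velocity_eq)
qed

lemma eulerian_acceleration_right_continuous:
  assumes "0 \<le> t" "y \<in> S"
  shows "continuous (at_right t) (\<lambda>s. eulerian_acceleration N x m v \<theta> (traj y s) s)"
  unfolding continuous_within
proof (rule tendsto_eventually)
  show "\<forall>\<^sub>F s in at_right t. eulerian_acceleration N x m v \<theta> (traj y s) s =
      eulerian_acceleration N x m v \<theta> (traj y t) t"
    using cluster_of_right[OF assms]
    by eventually_elim (use assms in \<open>simp add: eulerian_acceleration_eq\<close>)
qed

text \<open>The left limit is the velocity at time \<open>t\<close> of the cluster \<open>G\<close>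
  present just before \<open>t\<close>. At a shock it may differ from the value at \<open>t\<close>,
  as a merge conserves the total momentum but not the velocity of each constituent.\<close>

lemma eulerian_velocity_cadlag:
  assumes "y \<in> S"
  shows "cadlag_on {0<..} (\<lambda>s. eulerian_velocity N x m v \<theta> (traj y s) s)"
  unfolding cadlag_on_def
proof (intro ballI conjI)
  fix t :: real assume "t \<in> {0<..}"
  then have t: "0 < t" by simp
  show "continuous (at_right t) (\<lambda>s. eulerian_velocity N x m v \<theta> (traj y s) s)"
    using t assms by (intro DERIV_continuous[OF eulerian_velocity_right_derivative]) auto
  obtain G where G: "\<forall>\<^sub>F s in at_left t. 0 \<le> s \<and> cluster_at y s = G"
    using cluster_of_left[OF t assms] by blast
  have "\<forall>\<^sub>F s in at_left t. mean G v + s * mean G \<theta> = eulerian_velocity N x m v \<theta> (traj y s) s"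
    using G by eventually_elim (use assms in \<open>auto simp: eulerian_velocity_eq\<close>)
  moreover have "((\<lambda>s. mean G v + s * mean G \<theta>) \<longlongrightarrow> mean G v + t * mean G \<theta>) (at_left t)"
    by (intro tendsto_intros)
  ultimately show "\<exists>l. ((\<lambda>s. eulerian_velocity N x m v \<theta> (traj y s) s) \<longlongrightarrow> l) (at_left t)"
    by (blast intro: Lim_transform_eventually)
qed

lemma eulerian_acceleration_cadlag:
  assumes "y \<in> S"
  shows "cadlag_on {0<..} (\<lambda>s. eulerian_acceleration N x m v \<theta> (traj y s) s)"
  unfolding cadlag_on_def
proof (intro ballI conjI)
  fix t :: real assume "t \<in> {0<..}"
  then have t: "0 < t" by simp
  show "continuous (at_right t) (\<lambda>s. eulerian_acceleration N x m v \<theta> (traj y s) s)"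
    using t assms by (intro eulerian_acceleration_right_continuous) auto
  obtain G where G: "\<forall>\<^sub>F s in at_left t. 0 \<le> s \<and> cluster_at y s = G"
    using cluster_of_left[OF t assms] by blast
  have "\<forall>\<^sub>F s in at_left t. eulerian_acceleration N x m v \<theta> (traj y s) s = mean G \<theta>"
    using G by eventually_elim (use assms in \<open>auto simp: eulerian_acceleration_eq\<close>)
  then show "\<exists>l. ((\<lambda>s. eulerian_acceleration N x m v \<theta> (traj y s) s) \<longlongrightarrow> l) (at_left t)"
    by (blast intro: tendsto_eventually)
qed

section \<open>Lipschitz bounds and absolute continuity of trajectories\<close>

text \<open>On each side of \<open>t\<close> the particle follows one cluster parabola, and the left
  one ends at the true position at time \<open>t\<close>. A bound valid for the parabolas of all
  subsets of sites thus passes to the trajectory, whichever clusters occur.\<close>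

lemma flow_locally_lipschitz:
  assumes y: "y \<in> S" and t: "0 \<le> t"
    and lip: "\<And>G r s. G \<subseteq> S \<Longrightarrow> 0 \<le> r \<Longrightarrow> r \<le> T \<Longrightarrow> 0 \<le> s \<Longrightarrow> s \<le> T \<Longrightarrow>
      \<bar>pos G r - pos G s\<bar> \<le> L * \<bar>r - s\<bar>"
  shows "\<exists>\<delta>>0. \<forall>s. 0 \<le> s \<and> s \<le> T \<and> t \<le> T \<and> \<bar>s - t\<bar> < \<delta> \<longrightarrow> \<bar>traj y s - traj y t\<bar> \<le> L * \<bar>s - t\<bar>"
proof -
  let ?Q = "\<lambda>s. 0 \<le> s \<and> s \<le> T \<and> t \<le> T \<longrightarrow> \<bar>traj y s - traj y t\<bar> \<le> L * \<bar>s - t\<bar>"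
  have "\<forall>\<^sub>F s in at_right t. ?Q s"
    using cluster_of_right[OF t y]
  proof eventually_elim
    case (elim s)
    then show ?case
      using lip[OF cluster_of_subset[OF t y], of s t] t y by (simp add: flow_def)
  qed
  moreover have "\<forall>\<^sub>F s in at_left t. ?Q s"
  proof (cases "t = 0")
    \<comment> \<open>To the left of time 0 the guard \<open>0 \<le> s\<close> in \<open>?Q\<close>
      fails, so the claim is vacuous.\<close>
    case True
    have "\<forall>\<^sub>F s in at_left t. s < t" by (simp add: eventually_at_filter)
    then show ?thesis by eventually_elim (use True in simp)
  next
    case False
    then have "0 < t" using t by simp
    then obtain G where G: "G \<subseteq> S" "\<forall>\<^sub>F s in at_left t. 0 \<le> s \<and> cluster_at y s = G"
      "pos G t = pos (cluster_at y t) t"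
      using cluster_of_left[OF _ y] by blast
    show ?thesis
      using G(2) by eventually_elim (use lip[OF G(1), of _ t] t y G(3) in \<open>auto simp: flow_def\<close>)
  qed
  ultimately have "\<forall>\<^sub>F s in at t. ?Q s" by (simp add: eventually_at_split)
  then obtain \<delta> where "\<delta> > 0" "\<And>s. s \<noteq> t \<Longrightarrow> \<bar>s - t\<bar> < \<delta> \<Longrightarrow> ?Q s"
    by (auto simp: eventually_at dist_real_def)
  then show ?thesis by (intro exI[of _ \<delta>]) (metis abs_zero diff_self mult_zero_right order_refl)
qed

text \<open>Bounds with the same constant on adjacent intervals add up, and every time has a
  neighbourhood where the bound holds for intervals around that time; bisection of
  \<open>[a, b]\<close> turns this into the global bound.\<close>

lemma flow_lipschitz:
  assumes "y \<in> S"
  obtains L where "0 \<le> L" "\<And>a b. 0 \<le> a \<Longrightarrow> a \<le> b \<Longrightarrow> b \<le> T \<Longrightarrow> \<bar>traj y b - traj y a\<bar> \<le> L * (b - a)"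
proof -
  \<comment> \<open>The difference quotient of a cluster parabola between \<open>r\<close> and
    \<open>s\<close> is \<open>mean G v + (r + s) / 2 * mean G \<theta>\<close>, and
    \<open>(r + s) / 2\<close> is at most \<open>T\<close>. Summing over all subsets of sites
    dominates every cluster at once; \<open>\<bar>T\<bar>\<close> keeps \<open>L\<close> nonnegative
    for every \<open>T\<close>.\<close>
  define L where "L = (\<Sum>G\<in>Pow S. \<bar>mean G v\<bar> + \<bar>T\<bar> * \<bar>mean G \<theta>\<bar>)"
  have L0: "0 \<le> L" unfolding L_def by (intro sum_nonneg) auto
  have lip: "\<bar>pos G r - pos G s\<bar> \<le> L * \<bar>r - s\<bar>"
    if "G \<subseteq> S" "0 \<le> r" "r \<le> T" "0 \<le> s" "s \<le> T" for G r s
  proof -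
    have "pos G r - pos G s = (mean G v + (r + s) / 2 * mean G \<theta>) * (r - s)"
      by (simp add: pos_quadratic power2_eq_square field_simps)
    moreover have "\<bar>mean G v + (r + s) / 2 * mean G \<theta>\<bar> \<le> \<bar>mean G v\<bar> + \<bar>(r + s) / 2\<bar> * \<bar>mean G \<theta>\<bar>"
      by (metis abs_mult abs_triangle_ineq)
    moreover have "\<bar>(r + s) / 2\<bar> * \<bar>mean G \<theta>\<bar> \<le> \<bar>T\<bar> * \<bar>mean G \<theta>\<bar>"
      using that by (intro mult_right_mono) auto
    moreover have "\<bar>mean G v\<bar> + \<bar>T\<bar> * \<bar>mean G \<theta>\<bar> \<le> L"
      unfolding L_def using that(1) finite_sites
      by (intro member_le_sum[of G _ "\<lambda>G. \<bar>mean G v\<bar> + \<bar>T\<bar> * \<bar>mean G \<theta>\<bar>"]) auto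
    ultimately show ?thesis by (simp add: abs_mult mult_right_mono)
  qed
  show thesis
  proof (rule that[OF L0])
    fix a b :: real assume "0 \<le> a" "a \<le> b" "b \<le> T"
    have "0 \<le> a \<and> b \<le> T \<longrightarrow> \<bar>traj y b - traj y a\<bar> \<le> L * (b - a)"
      using \<open>a \<le> b\<close>
    proof (rule Bolzano[where P = "\<lambda>a b. 0 \<le> a \<and> b \<le> T \<longrightarrow> \<bar>traj y b - traj y a\<bar> \<le> L * (b - a)"])
      fix r s t assume "0 \<le> r \<and> s \<le> T \<longrightarrow> \<bar>traj y s - traj y r\<bar> \<le> L * (s - r)"
        "0 \<le> s \<and> t \<le> T \<longrightarrow> \<bar>traj y t - traj y s\<bar> \<le> L * (t - s)" "r \<le> s" "s \<le> t"
      then show "0 \<le> r \<and> t \<le> T \<longrightarrow> \<bar>traj y t - traj y r\<bar> \<le> L * (t - r)"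
        by (auto simp: algebra_simps)
    next
      fix t assume "a \<le> t" "t \<le> b"
      then have t: "0 \<le> t" "t \<le> T" using \<open>0 \<le> a\<close> \<open>b \<le> T\<close> by auto
      obtain \<delta> where \<delta>: "\<delta> > 0"
        "\<And>s. 0 \<le> s \<Longrightarrow> s \<le> T \<Longrightarrow> \<bar>s - t\<bar> < \<delta> \<Longrightarrow> \<bar>traj y s - traj y t\<bar> \<le> L * \<bar>s - t\<bar>"
        using flow_locally_lipschitz[OF assms t(1) lip] t(2) by blast
      \<comment> \<open>The interval contains \<open>t\<close>, so the two estimates centred at
        \<open>t\<close> add up to exactly \<open>L * (s - r)\<close>.\<close>
      have "\<bar>traj y s - traj y r\<bar> \<le> L * (s - r)"
        if "r \<le> t" "t \<le> s" "s - r < \<delta>" "0 \<le> r" "s \<le> T" for r s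
        using \<delta>(2)[of r] \<delta>(2)[of s] that by (simp add: algebra_simps)
      then show "\<exists>d>0. \<forall>r s. r \<le> t \<and> t \<le> s \<and> s - r < d \<longrightarrow>
          (0 \<le> r \<and> s \<le> T \<longrightarrow> \<bar>traj y s - traj y r\<bar> \<le> L * (s - r))"
        using \<delta>(1) by blast
    qed
    then show "\<bar>traj y b - traj y a\<bar> \<le> L * (b - a)"
      using \<open>0 \<le> a\<close> \<open>b \<le> T\<close> by blast
  qed
qed

lemma flow_absolutely_continuous:
  assumes "y \<in> S"
  shows "absolutely_continuous_on {0..T} (\<lambda>s. traj y s)"
  unfolding absolutely_continuous_on_def
proof (intro allI impI)
  fix \<epsilon> :: real assume "\<epsilon> > 0"
  obtain L where L: "0 \<le> L"
    "\<And>a b. 0 \<le> a \<Longrightarrow> a \<le> b \<Longrightarrow> b \<le> T \<Longrightarrow> \<bar>traj y b - traj y a\<bar> \<le> L * (b - a)"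
    using flow_lipschitz[OF assms] by blast
  \<comment> \<open>The 1 added to \<open>L\<close> avoids division by zero and makes the final
    inequality strict.\<close>
  have small: "(\<Sum>k<n. \<bar>traj y (b k) - traj y (a k)\<bar>) < \<epsilon>"
    if *: "\<forall>k<n. a k \<le> b k \<and> {a k..b k} \<subseteq> {0..T}" "(\<Sum>k<n. b k - a k) < \<epsilon> / (L + 1)"
    for n :: nat and a b
  proof -
    have "(\<Sum>k<n. \<bar>traj y (b k) - traj y (a k)\<bar>) \<le> (\<Sum>k<n. L * (b k - a k))"
      using * by (intro sum_mono L) auto
    also have "\<dots> = L * (\<Sum>k<n. b k - a k)" by (simp add: sum_distrib_left)
    also have "\<dots> \<le> L * (\<epsilon> / (L + 1))" using *(2) L(1) by (intro mult_left_mono) auto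
    also have "\<dots> < \<epsilon>" using L(1) \<open>\<epsilon> > 0\<close> by (simp add: field_simps)
    finally show ?thesis .
  qed
  show "\<exists>\<delta>>0. \<forall>(n::nat) a b. (\<forall>k<n. a k \<le> b k \<and> {a k..b k} \<subseteq> {0..T}) \<and>
      (\<forall>k<n. \<forall>l<n. k \<noteq> l \<longrightarrow> {a k<..<b k} \<inter> {a l<..<b l} = {}) \<and>
      (\<Sum>k<n. b k - a k) < \<delta> \<longrightarrow> (\<Sum>k<n. \<bar>traj y (b k) - traj y (a k)\<bar>) < \<epsilon>"
  proof (intro exI[of _ "\<epsilon> / (L + 1)"] conjI allI impI)
    show "0 < \<epsilon> / (L + 1)" using L(1) \<open>\<epsilon> > 0\<close> by simp
  next
    fix n :: nat and a b :: "nat \<Rightarrow> real"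
    assume "(\<forall>k<n. a k \<le> b k \<and> {a k..b k} \<subseteq> {0..T}) \<and>
      (\<forall>k<n. \<forall>l<n. k \<noteq> l \<longrightarrow> {a k<..<b k} \<inter> {a l<..<b l} = {}) \<and>
      (\<Sum>k<n. b k - a k) < \<epsilon> / (L + 1)"
    then show "(\<Sum>k<n. \<bar>traj y (b k) - traj y (a k)\<bar>) < \<epsilon>" by (intro small) blast+
  qed
qed

section \<open>Measurability and conditional expectations\<close>

lemma flow_measurable [measurable]: "(\<lambda>y. traj y t) \<in> borel_measurable borel"
proof -
  \<comment> \<open>The flow differs from the identity at most on the finite set of sites, so it is
    the identity plus a finite combination of indicators of points.\<close>
  have "traj y t = y + (\<Sum>a\<in>S. indicator {a} y * (traj a t - a))" for y
  proof (cases "y \<in> S")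
    case True
    have "(\<Sum>a\<in>S. indicator {a} y * (traj a t - a)) = (\<Sum>a\<in>S. if a = y then traj a t - a else 0)"
      by (intro sum.cong) (auto simp: indicator_def)
    then show ?thesis using True finite_sites by simp
  next
    case False
    then have "(\<Sum>a\<in>S. indicator {a} y * (traj a t - a)) = 0"
      by (intro sum.neutral) (auto simp: indicator_def)
    then show ?thesis using False by (simp add: flow_def)
  qed
  then have eq: "(\<lambda>y. traj y t) = (\<lambda>y. y + (\<Sum>a\<in>S. indicator {a} y * (traj a t - a)))"
    by (rule ext)
  show ?thesis by (subst eq) measurable
qed

end

text \<open>Sets of the generated sigma-algebra are preimages under \<open>f\<close> and cannot
  separate points with the same \<open>f\<close>-value; this is applied to a level set of
  \<open>g\<close>. The conclusion holds everywhere, not merely almost everywhere.\<close>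

lemma vimage_algebra_measurable_constant:
  fixes f :: "'a \<Rightarrow> real" and g :: "'a \<Rightarrow> real"
  assumes "g \<in> borel_measurable (vimage_algebra \<Omega> f borel)"
    and "\<omega> \<in> \<Omega>" "\<omega>' \<in> \<Omega>" "f \<omega> = f \<omega>'"
  shows "g \<omega> = g \<omega>'"
proof -
  have "g -` {g \<omega>} \<inter> \<Omega> \<in> sets (vimage_algebra \<Omega> f borel)"
    using measurable_sets[OF assms(1), of "{g \<omega>}"] by simp
  then obtain B where B: "g -` {g \<omega>} \<inter> \<Omega> = f -` B \<inter> \<Omega>"
    by (auto simp: sets_vimage_algebra2)
  have "\<omega> \<in> f -` B \<inter> \<Omega>" using assms(2) unfolding B[symmetric] by simp
  then have "\<omega>' \<in> f -` B \<inter> \<Omega>" using assms(3,4) by simp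
  then have "\<omega>' \<in> g -` {g \<omega>} \<inter> \<Omega>" unfolding B .
  then show ?thesis by simp
qed

locale sticky_process = sticky_particles N x m v \<theta> + prob_space M
  for N :: nat and x m v \<theta> :: "nat \<Rightarrow> real" and M :: "'a measure" +
  fixes X\<^sub>0 :: "'a \<Rightarrow> real"
  assumes X0_measurable [measurable]: "X\<^sub>0 \<in> borel_measurable M"
    and distr_X0: "distr M borel X\<^sub>0 = init_mass N x m"
begin

text \<open>The complement is the only null event that is ever discarded, and it does not depend on
  time.\<close>

lemma AE_initial_site: "AE \<omega> in M. X\<^sub>0 \<omega> \<in> S"
proof -
  have [measurable]: "S \<in> sets borel" by (rule borel_if_subset_sites) simp
  have "AE j in point_measure {1..N} (\<lambda>j. ennreal (m j)). x j \<in> S"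
    by (auto simp: AE_point_measure sites_def)
  then have "AE y in init_mass N x m. y \<in> S"
    unfolding init_mass_def by (subst AE_distr_iff[OF init_mass_index_measurable]) auto
  then show ?thesis
    unfolding distr_X0[symmetric] by (subst (asm) AE_distr_iff) auto
qed

lemma integrable_initial:
  fixes f :: "real \<Rightarrow> real"
  assumes [measurable]: "f \<in> borel_measurable borel"
  shows "integrable M (\<lambda>\<omega>. f (X\<^sub>0 \<omega>))"
  using integrable_init_mass[OF assms] unfolding distr_X0[symmetric]
  by (subst (asm) integrable_distr_eq) auto

lemma set_integral_initial:
  fixes f :: "real \<Rightarrow> real"
  assumes [measurable]: "f \<in> borel_measurable borel" "B \<in> sets borel"
  shows "(LINT \<omega>:{\<omega> \<in> space M. X\<^sub>0 \<omega> \<in> B}|M. f (X\<^sub>0 \<omega>)) =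
    (\<Sum>j | j \<in> {1..N} \<and> x j \<in> B. m j * f (x j))"
proof -
  have "(LINT \<omega>:{\<omega> \<in> space M. X\<^sub>0 \<omega> \<in> B}|M. f (X\<^sub>0 \<omega>)) =
      (LINT \<omega>|M. indicator B (X\<^sub>0 \<omega>) * f (X\<^sub>0 \<omega>))"
    unfolding set_lebesgue_integral_def
    by (intro Bochner_Integration.integral_cong) (auto simp: indicator_def)
  also have "\<dots> = (LINT y|distr M borel X\<^sub>0. indicator B y * f y)"
    by (subst integral_distr) auto
  also have "\<dots> = (LINT y:B|init_mass N x m. f y)"
    by (simp add: distr_X0 set_lebesgue_integral_def)
  finally show ?thesis by (simp add: set_integral_init_mass)
qed

text \<open>The event \<open>{X\<^sub>t = X\<^sub>t(\<omega>)}\<close> is an atom of positive probability, which pins down every version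
  of the conditional expectation at \<open>\<omega>\<close>; this is what allows the exceptional set to be chosen
  independently of \<open>t\<close>.\<close>

lemma cond_exp_eq_mean:
  fixes f :: "real \<Rightarrow> real"
  assumes t: "0 \<le> t" and \<omega>: "\<omega> \<in> space M" "X\<^sub>0 \<omega> \<in> S" and f [measurable]: "f \<in> borel_measurable borel"
  shows "real_cond_exp M (vimage_algebra (space M) (\<lambda>\<omega>. traj (X\<^sub>0 \<omega>) t) borel) (\<lambda>\<omega>. f (X\<^sub>0 \<omega>)) \<omega> =
    mean (cluster_at (X\<^sub>0 \<omega>) t) (\<lambda>j. f (x j))"
proof -
  let ?F = "vimage_algebra (space M) (\<lambda>\<omega>. traj (X\<^sub>0 \<omega>) t) borel"
  let ?E = "real_cond_exp M ?F (\<lambda>\<omega>. f (X\<^sub>0 \<omega>))"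
  let ?G = "cluster_at (X\<^sub>0 \<omega>) t"
  define B where "B = {y. traj y t = traj (X\<^sub>0 \<omega>) t}"
  define A where "A = {\<omega> \<in> space M. X\<^sub>0 \<omega> \<in> B}"
  have B [measurable]: "B \<in> sets borel" unfolding B_def by measurable
  have X: "(\<lambda>\<omega>. traj (X\<^sub>0 \<omega>) t) \<in> borel_measurable M" by measurable
  have sub: "subalgebra M ?F"
    using measurable_iff_sets[of "\<lambda>\<omega>. traj (X\<^sub>0 \<omega>) t" M borel] X by (simp add: subalgebra_def)
  interpret finite_measure_subalgebra M ?F by unfold_locales (rule sub)
  have A: "A \<in> sets ?F"
  proof -
    have "A = (\<lambda>\<omega>. traj (X\<^sub>0 \<omega>) t) -` {traj (X\<^sub>0 \<omega>) t} \<inter> space M" by (auto simp: A_def B_def)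
    then show ?thesis by (simp add: in_vimage_algebra)
  qed
  then have AM: "A \<in> sets M" using sub by (auto simp: subalgebra_def)
  \<comment> \<open>As a subset of the line, \<open>B\<close> may also contain a point off the
    sites, where the flow is the identity; among the sites it is exactly the cluster.\<close>
  have idx: "{j. j \<in> {1..N} \<and> x j \<in> B} = {j. j \<in> {1..N} \<and> x j \<in> ?G}"
  proof -
    have "y \<in> B \<longleftrightarrow> y \<in> ?G" if "y \<in> S" for y
      using flow_eq_iff[OF t that \<omega>(2)] cluster_of_in[OF t that] cluster_of_in[OF t \<omega>(2)]
        cluster_of_eqI[OF clusters_partition(1)[OF t]] unfolding B_def by blast
    then show ?thesis unfolding sites_def by blast
  qed
  have "(LINT \<omega>':A|M. ?E \<omega>') = (LINT \<omega>':A|M. f (X\<^sub>0 \<omega>'))"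
    by (rule real_cond_exp_intA[symmetric, OF integrable_initial[OF f] A])
  also have "\<dots> = (\<Sum>j | j \<in> {1..N} \<and> x j \<in> ?G. m j * f (x j))"
    unfolding A_def by (simp only: set_integral_initial[OF f B] idx)
  finally have 1: "(LINT \<omega>':A|M. ?E \<omega>') = (\<Sum>j | j \<in> {1..N} \<and> x j \<in> ?G. m j * f (x j))" .
  \<comment> \<open>On the level set \<open>A\<close> the conditional expectation is constant, so
    its integral is its value at \<omega> times the mass of the cluster.\<close>
  have "(LINT \<omega>':A|M. ?E \<omega>') = (LINT \<omega>':A|M. ?E \<omega>)"
  proof (rule set_lebesgue_integral_cong[OF AM], intro allI impI)
    fix \<omega>' assume "\<omega>' \<in> A"
    then show "?E \<omega>' = ?E \<omega>"
      using \<omega>(1) by (intro vimage_algebra_measurable_constant[OF borel_measurable_cond_exp])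
        (auto simp: A_def B_def)
  qed
  also have "\<dots> = ?E \<omega> * (LINT \<omega>':A|M. 1)" by (simp add: set_lebesgue_integral_def)
  also have "(LINT \<omega>':A|M. 1) = mass ?G"
    using set_integral_initial[OF borel_measurable_const[of 1] B]
    unfolding A_def mass_def by (simp only: idx mult_1_right)
  finally have 2: "(LINT \<omega>':A|M. ?E \<omega>') = ?E \<omega> * mass ?G" .
  have "0 < mass ?G"
    using cluster_of_subset[OF t \<omega>(2)] cluster_of_in[OF t \<omega>(2)] by (intro mass_pos) auto
  then show ?thesis using 1 2 by (simp add: mean_def eq_divide_eq)
qed

end

theorem proposition4p1:
  fixes N :: nat and x m v \<theta> :: "nat \<Rightarrow> real"
    and M :: "'a measure" and X\<^sub>0 :: "'a \<Rightarrow> real"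
    and P\<^sub>0 :: "real measure" and u\<^sub>0 \<gamma>\<^sub>0 :: "real \<Rightarrow> real"
    and \<phi> u \<gamma> :: "real \<Rightarrow> real \<Rightarrow> real"
    and X :: "real \<Rightarrow> 'a \<Rightarrow> real" and E :: "('a \<Rightarrow> real) \<Rightarrow> real \<Rightarrow> 'a \<Rightarrow> real"
  defines "P\<^sub>0 \<equiv> init_mass N x m"
    and "u\<^sub>0 \<equiv> init_fun N x v"
    and "\<gamma>\<^sub>0 \<equiv> init_fun N x \<theta>"
    and "\<phi> \<equiv> flow N x m v \<theta>"
    and "u \<equiv> eulerian_velocity N x m v \<theta>"
    and "\<gamma> \<equiv> eulerian_acceleration N x m v \<theta>"
    and "X \<equiv> \<lambda>t \<omega>. \<phi> (X\<^sub>0 \<omega>) t"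
    and "E \<equiv> \<lambda>Y t. real_cond_exp M (vimage_algebra (space M) (X t) borel) Y"
  assumes "strict_mono_on {1..N} x"
    and "\<And>j. j \<in> {1..N} \<Longrightarrow> 0 < m j"
    and "(\<Sum>j\<in>{1..N}. m j) = 1"
    and "antimono_on (sites N x) \<gamma>\<^sub>0"
    and "prob_space M"
    and "X\<^sub>0 \<in> borel_measurable M"
    and "distr M borel X\<^sub>0 = P\<^sub>0"
  shows
    "(AE \<omega> in M.
        (\<forall>T>0. absolutely_continuous_on {0..T} (\<lambda>t. X t \<omega>)) \<and>
        cadlag_on {0<..} (\<lambda>t. u (X t \<omega>) t) \<and>
        cadlag_on {0<..} (\<lambda>t. \<gamma> (X t \<omega>) t) \<and>
        continuous (at_right 0) (\<lambda>t. X t \<omega>) \<and>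
        continuous (at_right 0) (\<lambda>t. u (X t \<omega>) t) \<and>
        continuous (at_right 0) (\<lambda>t. \<gamma> (X t \<omega>) t)) \<and>
     (AE \<omega> in M. \<forall>t\<ge>0.
        ((\<lambda>s. X s \<omega>) has_real_derivative
            E (\<lambda>\<omega>. u\<^sub>0 (X\<^sub>0 \<omega>) + t * \<gamma>\<^sub>0 (X\<^sub>0 \<omega>)) t \<omega>) (at_right t) \<and>
        ((\<lambda>s. u (X s \<omega>) s) has_real_derivative
            E (\<lambda>\<omega>. \<gamma>\<^sub>0 (X\<^sub>0 \<omega>)) t \<omega>) (at_right t)) \<and>
     (\<forall>t\<ge>0. AE \<omega> in M.
        X t \<omega> = E (\<lambda>\<omega>. X\<^sub>0 \<omega> + t * u\<^sub>0 (X\<^sub>0 \<omega>) + t\<^sup>2 / 2 * \<gamma>\<^sub>0 (X\<^sub>0 \<omega>)) t \<omega> \<and>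
        u (X t \<omega>) t = E (\<lambda>\<omega>. u\<^sub>0 (X\<^sub>0 \<omega>) + t * \<gamma>\<^sub>0 (X\<^sub>0 \<omega>)) t \<omega> \<and>
        \<gamma> (X t \<omega>) t = E (\<lambda>\<omega>. \<gamma>\<^sub>0 (X\<^sub>0 \<omega>)) t \<omega>)"
proof -
  interpret prob_space M by fact
  have "inj_on x {1..N}" using assms(9) by (rule strict_mono_on_imp_inj_on)
  then interpret sticky_process N x m v \<theta> M X\<^sub>0
    using assms(10,14,15) unfolding P\<^sub>0_def by unfold_locales auto
  have E: "E (\<lambda>\<omega>. f (X\<^sub>0 \<omega>)) t \<omega> = mean (cluster_at (X\<^sub>0 \<omega>) t) (\<lambda>j. f (x j))"
    if "0 \<le> t" "\<omega> \<in> space M" "X\<^sub>0 \<omega> \<in> S" "f \<in> borel_measurable borel" for f t \<omega>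
    unfolding E_def X_def \<phi>_def using that by (rule cond_exp_eq_mean)
  have E_acceleration: "E (\<lambda>\<omega>. \<gamma>\<^sub>0 (X\<^sub>0 \<omega>)) t \<omega> = mean (cluster_at (X\<^sub>0 \<omega>) t) \<theta>"
    if "0 \<le> t" "\<omega> \<in> space M" "X\<^sub>0 \<omega> \<in> S" for t \<omega>
    using E[OF that, of \<gamma>\<^sub>0] by (simp add: \<gamma>\<^sub>0_def mean_init_fun)
  have E_velocity: "E (\<lambda>\<omega>. u\<^sub>0 (X\<^sub>0 \<omega>) + t * \<gamma>\<^sub>0 (X\<^sub>0 \<omega>)) t \<omega> =
      mean (cluster_at (X\<^sub>0 \<omega>) t) v + t * mean (cluster_at (X\<^sub>0 \<omega>) t) \<theta>"
    if "0 \<le> t" "\<omega> \<in> space M" "X\<^sub>0 \<omega> \<in> S" for t \<omega>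
    using E[OF that, of "\<lambda>y. u\<^sub>0 y + t * \<gamma>\<^sub>0 y"]
    by (simp add: u\<^sub>0_def \<gamma>\<^sub>0_def mean_add mean_scale mean_init_fun)
  have E_position: "E (\<lambda>\<omega>. X\<^sub>0 \<omega> + t * u\<^sub>0 (X\<^sub>0 \<omega>) + t\<^sup>2 / 2 * \<gamma>\<^sub>0 (X\<^sub>0 \<omega>)) t \<omega> =
      pos (cluster_at (X\<^sub>0 \<omega>) t) t"
    if "0 \<le> t" "\<omega> \<in> space M" "X\<^sub>0 \<omega> \<in> S" for t \<omega>
  proof -
    have "E (\<lambda>\<omega>. X\<^sub>0 \<omega> + t * u\<^sub>0 (X\<^sub>0 \<omega>) + t\<^sup>2 / 2 * \<gamma>\<^sub>0 (X\<^sub>0 \<omega>)) t \<omega> =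
        mean (cluster_at (X\<^sub>0 \<omega>) t) (\<lambda>j. x j + t * u\<^sub>0 (x j) + t\<^sup>2 / 2 * \<gamma>\<^sub>0 (x j))"
      by (rule E[OF that]) (simp add: u\<^sub>0_def \<gamma>\<^sub>0_def)
    then show ?thesis
      by (simp only: pos_quadratic mean_add mean_scale mean_init_fun u\<^sub>0_def \<gamma>\<^sub>0_def)
  qed
  \<comment> \<open>One almost sure event serves all three claims, including the right derivatives,
    where the quantifier over \<open>t\<close> stands inside \<open>AE\<close>.\<close>
  have sites: "AE \<omega> in M. \<omega> \<in> space M \<and> X\<^sub>0 \<omega> \<in> S"
    using AE_space AE_initial_site by eventually_elim simp
  show ?thesis
  proof (intro conjI)
    show "AE \<omega> in M.
        (\<forall>T>0. absolutely_continuous_on {0..T} (\<lambda>t. X t \<omega>)) \<and>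
        cadlag_on {0<..} (\<lambda>t. u (X t \<omega>) t) \<and>
        cadlag_on {0<..} (\<lambda>t. \<gamma> (X t \<omega>) t) \<and>
        continuous (at_right 0) (\<lambda>t. X t \<omega>) \<and>
        continuous (at_right 0) (\<lambda>t. u (X t \<omega>) t) \<and>
        continuous (at_right 0) (\<lambda>t. \<gamma> (X t \<omega>) t)"
      using sites
    proof eventually_elim
      case (elim \<omega>)
      then have y: "X\<^sub>0 \<omega> \<in> S" by simp
      show ?case
        unfolding X_def \<phi>_def u_def \<gamma>_def
        \<comment> \<open>Right-continuity at 0 follows from the right derivatives at 0 for position
          and velocity; the acceleration is constant just after 0.\<close>
        using flow_absolutely_continuous[OF y] eulerian_velocity_cadlag[OF y]
          eulerian_acceleration_cadlag[OF y] DERIV_continuous[OF flow_right_derivative[OF order_refl y]]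
          DERIV_continuous[OF eulerian_velocity_right_derivative[OF order_refl y]]
          eulerian_acceleration_right_continuous[OF order_refl y]
        by blast
    qed
    show "AE \<omega> in M. \<forall>t\<ge>0.
        ((\<lambda>s. X s \<omega>) has_real_derivative
            E (\<lambda>\<omega>. u\<^sub>0 (X\<^sub>0 \<omega>) + t * \<gamma>\<^sub>0 (X\<^sub>0 \<omega>)) t \<omega>) (at_right t) \<and>
        ((\<lambda>s. u (X s \<omega>) s) has_real_derivative
            E (\<lambda>\<omega>. \<gamma>\<^sub>0 (X\<^sub>0 \<omega>)) t \<omega>) (at_right t)"
      using sites
    proof eventually_elim
      case (elim \<omega>)
      then have \<omega>: "\<omega> \<in> space M" "X\<^sub>0 \<omega> \<in> S" by auto
      show ?case
      proof (intro allI impI)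
        fix t :: real assume t: "0 \<le> t"
        show "((\<lambda>s. X s \<omega>) has_real_derivative
              E (\<lambda>\<omega>. u\<^sub>0 (X\<^sub>0 \<omega>) + t * \<gamma>\<^sub>0 (X\<^sub>0 \<omega>)) t \<omega>) (at_right t) \<and>
            ((\<lambda>s. u (X s \<omega>) s) has_real_derivative
              E (\<lambda>\<omega>. \<gamma>\<^sub>0 (X\<^sub>0 \<omega>)) t \<omega>) (at_right t)"
          unfolding E_velocity[OF t \<omega>] E_acceleration[OF t \<omega>] X_def \<phi>_def u_def
          using flow_right_derivative[OF t \<omega>(2)] eulerian_velocity_right_derivative[OF t \<omega>(2)]
          by blast
      qed
    qed
    show "\<forall>t\<ge>0. AE \<omega> in M.
        X t \<omega> = E (\<lambda>\<omega>. X\<^sub>0 \<omega> + t * u\<^sub>0 (X\<^sub>0 \<omega>) + t\<^sup>2 / 2 * \<gamma>\<^sub>0 (X\<^sub>0 \<omega>)) t \<omega> \<and>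
        u (X t \<omega>) t = E (\<lambda>\<omega>. u\<^sub>0 (X\<^sub>0 \<omega>) + t * \<gamma>\<^sub>0 (X\<^sub>0 \<omega>)) t \<omega> \<and>
        \<gamma> (X t \<omega>) t = E (\<lambda>\<omega>. \<gamma>\<^sub>0 (X\<^sub>0 \<omega>)) t \<omega>"
    proof (intro allI impI)
      fix t :: real assume t: "0 \<le> t"
      show "AE \<omega> in M.
          X t \<omega> = E (\<lambda>\<omega>. X\<^sub>0 \<omega> + t * u\<^sub>0 (X\<^sub>0 \<omega>) + t\<^sup>2 / 2 * \<gamma>\<^sub>0 (X\<^sub>0 \<omega>)) t \<omega> \<and>
          u (X t \<omega>) t = E (\<lambda>\<omega>. u\<^sub>0 (X\<^sub>0 \<omega>) + t * \<gamma>\<^sub>0 (X\<^sub>0 \<omega>)) t \<omega> \<and>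
          \<gamma> (X t \<omega>) t = E (\<lambda>\<omega>. \<gamma>\<^sub>0 (X\<^sub>0 \<omega>)) t \<omega>"
        using sites
      proof eventually_elim
        case (elim \<omega>)
        then have \<omega>: "\<omega> \<in> space M" "X\<^sub>0 \<omega> \<in> S" by auto
        show ?case
          unfolding E_position[OF t \<omega>] E_velocity[OF t \<omega>] E_acceleration[OF t \<omega>] X_def \<phi>_def
            u_def \<gamma>_def eulerian_velocity_eq[OF t \<omega>(2)] eulerian_acceleration_eq[OF t \<omega>(2)]
          using \<omega>(2) by (simp add: flow_def)
      qed
    qed
  qed
qed

end
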